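(* Let $\mathcal{M}=(E,\mathcal{C})$ be a binary matroid, let $I\mathcal{M}$ be its cycle ideal in $\mathbb{R}[x_e : e\in E]$, let $\mathcal{F}=\{F_1,\dots,F_N\}$ be a set of distinct representatives of the equivalence classes of the relation $F\sim F' \iff F\Delta F'\in\mathcal{C}^*$ on the set of all subsets of $E$, and let $$\mathcal{B}=\{\mathbf{x}^F+I\mathcal{M} : F\in\mathcal{F}\},\qquad \mathcal{H}=\{x_e^2-1 : e\in E\}\cup\{1-\mathbf{x}^D : D \text{ a chordless cocircuit of } \mathcal{M}\}.$$ Then the set $\mathcal{B}$ is a basis of the real vector space $\mathbb{R}[x_e:e\in E]/I\mathcal{M}$, and the set $\mathcal{H}$ generates the ideal $I\mathcal{M}$.
   Context: A binary matroid is a pair $\mathcal{M}=(E,\mathcal{C})$ with $E$ a finite set and $\mathcal{C}$ a (nonempty) collection of subsets of $E$ closed under symmetric difference $\Delta$; members of $\mathcal{C}$ are the cycles. The cocycles are the members of $\mathcal{C}^*=\{D\subseteq E : |D\cap C| \text{ even for all } C\in\mathcal{C}\}$; cocircuits are the inclusion-minimal nonempty cocycles. For a cocycle $D$, an element $e\in E\setminus D$ is a chord of $D$ if there are $D_1,D_2\in\mathcal{C}^*$ with $D_1\cap D_2=\{e\}$ and $D=D_1\Delta D_2$; $D$ is chordless if it has no chord. For $F\subseteq E$, $\mathbf{x}^F=\prod_{e\in F}x_e$. For $C\in\mathcal{C}$, the cycle vector $\chi^C\in\{\pm1\}^E$ has $\chi^C_e=-1$ if $e\in C$ and $\chi^C_e=1$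 otherwise. The cycle ideal $I\mathcal{M}$ is the ideal of all polynomials in $\mathbb{R}[x_e:e\in E]$ vanishing at $\chi^C$ for every $C\in\mathcal{C}$.
   Formalization: That H generates IM is stated only when every cocircuit has at least 3 elements; without this it fails, e.g. for E={0,1,2}, C={∅,E}, where every cocircuit has a chord. The basis claim is unrestricted. *)

theory Defs
  imports
    "HOL-Library.Poly_Mapping"
    "HOL-Algebra.QuotRing"
    "Jordan_Normal_Form.VS_Connect"
begin

section \<open>Binary matroids\<close>

locale binary_matroid =
  fixes E :: "'e set" and \<C> :: "'e set set"
  assumes finite_ground: "finite E"
    and cycles_nonempty: "\<C> \<noteq> {}"
    and cycles_subset: "\<C> \<subseteq> Pow E"
    and cycles_sym_diff: "\<lbrakk>C \<in> \<C>; C' \<in> \<C>\<rbrakk> \<Longrightarrow> sym_diff C C' \<in> \<C>"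

definition cocycles :: "'e set \<Rightarrow> 'e set set \<Rightarrow> 'e set set" where
  "cocycles E \<C> = {D. D \<subseteq> E \<and> (\<forall>C\<in>\<C>. even (card (D \<inter> C)))}"

definition cocircuits :: "'e set \<Rightarrow> 'e set set \<Rightarrow> 'e set set" where
  "cocircuits E \<C> = {D \<in> cocycles E \<C>. D \<noteq> {} \<and>
     (\<forall>D'\<in>cocycles E \<C>. D' \<noteq> {} \<longrightarrow> D' \<subseteq> D \<longrightarrow> D' = D)}"

definition is_chord :: "'e set \<Rightarrow> 'e set set \<Rightarrow> 'e set \<Rightarrow> 'e \<Rightarrow> bool" where
  "is_chord E \<C> D e \<longleftrightarrow> e \<in> E - D \<and>
     (\<exists>D1\<in>cocycles E \<C>. \<exists>D2\<in>cocycles E \<C>. D1 \<inter> D2 = {e} \<and> D = sym_diff D1 D2)"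

definition chordless :: "'e set \<Rightarrow> 'e set set \<Rightarrow> 'e set \<Rightarrow> bool" where
  "chordless E \<C> D \<longleftrightarrow> \<not> (\<exists>e. is_chord E \<C> D e)"

text \<open>
  The dual matroid is simple: there are no coloops and no two elements in series.
  Without this, chordless cocircuits need not generate the cycle ideal: if \<open>E\<close> has three
  elements and \<open>\<C> = {{}, E}\<close>, the cocircuits are the three two-element subsets of \<open>E\<close>,
  and each has the remaining element as a chord (see \<open>generators_fail_without_cosimple\<close>).
\<close>

definition cosimple :: "'e set \<Rightarrow> 'e set set \<Rightarrow> bool" where
  "cosimple E \<C> \<longleftrightarrow> (\<forall>D\<in>cocircuits E \<C>. 3 \<le> card D)"

definition cocycle_rel :: "'e set \<Rightarrow> 'e set set \<Rightarrow> ('e set \<times> 'e set) set" where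
  "cocycle_rel E \<C> = {(F, F'). F \<subseteq> E \<and> F' \<subseteq> E \<and> sym_diff F F' \<in> cocycles E \<C>}"

definition distinct_representatives :: "'a set \<Rightarrow> ('a \<times> 'a) set \<Rightarrow> 'a set \<Rightarrow> bool" where
  "distinct_representatives A r \<F> \<longleftrightarrow> \<F> \<subseteq> A \<and> (\<forall>X\<in>A // r. \<exists>!F. F \<in> \<F> \<and> F \<in> X)"


section \<open>The polynomial ring and the cycle ideal\<close>

text \<open>
  A polynomial is a finitely supported map from exponent vectors to coefficients;
  \<open>*\<close> on \<^typ>\<open>('e \<Rightarrow>\<^sub>0 nat) \<Rightarrow>\<^sub>0 real\<close> is convolution, i.e. polynomial multiplication.
\<close>

type_synonym 'e rpoly = "('e \<Rightarrow>\<^sub>0 nat) \<Rightarrow>\<^sub>0 real"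

definition Const :: "real \<Rightarrow> 'e rpoly" where
  "Const c = Poly_Mapping.single 0 c"

definition Var :: "'e \<Rightarrow> 'e rpoly" where
  "Var e = Poly_Mapping.single (Poly_Mapping.single e 1) 1"

definition monom_set :: "'e set \<Rightarrow> 'e rpoly" where
  "monom_set F = (\<Prod>e\<in>F. Var e)"

definition peval :: "('e \<Rightarrow> real) \<Rightarrow> 'e rpoly \<Rightarrow> real" where
  "peval x p = (\<Sum>m\<in>Poly_Mapping.keys p. Poly_Mapping.lookup p m *
     (\<Prod>e\<in>Poly_Mapping.keys m. x e ^ Poly_Mapping.lookup m e))"

definition poly_ring :: "'e set \<Rightarrow> 'e rpoly ring" where
  "poly_ring E = \<lparr>carrier = {p. \<forall>m\<in>Poly_Mapping.keys p. Poly_Mapping.keys m \<subseteq> E},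
     mult = (*), one = 1, zero = 0, add = (+)\<rparr>"

definition cycle_vector :: "'e set \<Rightarrow> 'e \<Rightarrow> real" where
  "cycle_vector C e = (if e \<in> C then - 1 else 1)"

definition cycle_ideal :: "'e set \<Rightarrow> 'e set set \<Rightarrow> 'e rpoly set" where
  "cycle_ideal E \<C> = {p \<in> carrier (poly_ring E). \<forall>C\<in>\<C>. peval (cycle_vector C) p = 0}"

text \<open>
  The quotient ring as a real vector space: a scalar acts as multiplication by the
  coset of the corresponding constant polynomial.
\<close>

definition quotient_space :: "'e set \<Rightarrow> 'e rpoly set \<Rightarrow> (real, 'e rpoly set) module" where
  "quotient_space E I = ring.extend (poly_ring E Quot I)
     \<lparr>smult = (\<lambda>c X. (I +>\<^bsub>poly_ring E\<^esub> Const c) \<otimes>\<^bsub>poly_ring E Quot I\<^esub> X)\<rparr>"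

definition monomial_cosets :: "'e set \<Rightarrow> 'e set set \<Rightarrow> 'e set set \<Rightarrow> 'e rpoly set set" where
  "monomial_cosets E \<C> \<F> = {cycle_ideal E \<C> +>\<^bsub>poly_ring E\<^esub> monom_set F | F. F \<in> \<F>}"

definition cycle_generators :: "'e set \<Rightarrow> 'e set set \<Rightarrow> 'e rpoly set" where
  "cycle_generators E \<C> = {Var e ^ 2 - 1 | e. e \<in> E} \<union>
     {1 - monom_set D | D. D \<in> cocircuits E \<C> \<and> chordless E \<C> D}"


section \<open>The quotient is a vector space\<close>

lemma peval_superset:
  assumes "finite S" "Poly_Mapping.keys p \<subseteq> S"
  shows "peval x p = (\<Sum>m\<in>S. Poly_Mapping.lookup p m *
     (\<Prod>e\<in>Poly_Mapping.keys m. x e ^ Poly_Mapping.lookup m e))"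
  unfolding peval_def
  by (rule sum.mono_neutral_left) (use assms in \<open>auto simp: in_keys_iff\<close>)

lemma peval_zero [simp]: "peval x 0 = 0"
  by (simp add: peval_def)

lemma peval_add: "peval x (p + q) = peval x p + peval x q"
proof -
  let ?S = "Poly_Mapping.keys p \<union> Poly_Mapping.keys q"
  have f: "finite ?S" and s: "Poly_Mapping.keys (p + q) \<subseteq> ?S"
    by (auto simp: Poly_Mapping.keys_add)
  show ?thesis
    by (subst (1 2 3) peval_superset[OF f]) (use s in \<open>auto simp: lookup_add sum.distrib algebra_simps\<close>)
qed

lemma peval_single:
  "peval x (Poly_Mapping.single m c) = c * (\<Prod>e\<in>Poly_Mapping.keys m. x e ^ Poly_Mapping.lookup m e)"
  by (subst peval_superset[of "{m}"]) auto

lemma monomial_eval_add: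
  fixes x :: "'e \<Rightarrow> real"
  shows "(\<Prod>e\<in>Poly_Mapping.keys (m + n). x e ^ Poly_Mapping.lookup (m + n) e) =
   (\<Prod>e\<in>Poly_Mapping.keys m. x e ^ Poly_Mapping.lookup m e) *
   (\<Prod>e\<in>Poly_Mapping.keys n. x e ^ Poly_Mapping.lookup n e)"
proof -
  let ?S = "Poly_Mapping.keys m \<union> Poly_Mapping.keys n"
  have *: "(\<Prod>e\<in>Poly_Mapping.keys k. x e ^ Poly_Mapping.lookup k e) =
      (\<Prod>e\<in>?S. x e ^ Poly_Mapping.lookup k e)" if "Poly_Mapping.keys k \<subseteq> ?S" for k
    by (rule prod.mono_neutral_left) (use that in \<open>auto simp: in_keys_iff\<close>)
  show ?thesis
    by (subst (1 2 3) *) (auto simp: Poly_Mapping.keys_add lookup_add power_add prod.distrib)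
qed

lemma rpoly_induct [case_names zero add]:
  assumes "P 0" and step: "\<And>m c p. P p \<Longrightarrow> P (Poly_Mapping.single m c + p)"
  shows "P (p :: 'e rpoly)"
proof (induction p rule: update_induct)
  case (update f a b)
  have "Poly_Mapping.update a b f = Poly_Mapping.single a b + f"
    using update(1) by (intro poly_mapping_eqI)
      (auto simp: lookup_update lookup_add lookup_single in_keys_iff when_def)
  with step[OF update(3)] show ?case by simp
qed (rule assms(1))

lemma peval_mult: "peval x (p * q) = peval x p * peval x q"
proof (induction p rule: rpoly_induct)
  case (add m c p)
  have "peval x (Poly_Mapping.single m c * q) = peval x (Poly_Mapping.single m c) * peval x q"
    by (induction q rule: rpoly_induct)
      (simp_all add: distrib_left peval_add mult_single peval_single monomial_eval_add)
  with add show ?case by (simp add: distrib_right peval_add)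
qed simp

lemma cring_poly_ring: "cring (poly_ring E)"
proof (rule cringI)
  have *: "Poly_Mapping.keys (m + n) \<subseteq> Poly_Mapping.keys m \<union> Poly_Mapping.keys n" for m n :: "'e \<Rightarrow>\<^sub>0 nat"
    by (rule Poly_Mapping.keys_add)
  show "abelian_group (poly_ring E)"
  proof (rule abelian_groupI)
    fix p q assume "p \<in> carrier (poly_ring E)" "q \<in> carrier (poly_ring E)"
    then show "p \<oplus>\<^bsub>poly_ring E\<^esub> q \<in> carrier (poly_ring E)"
      using Poly_Mapping.keys_add[of p q] by (auto simp: poly_ring_def)
  next
    fix p assume "p \<in> carrier (poly_ring E)"
    then show "\<exists>q\<in>carrier (poly_ring E). q \<oplus>\<^bsub>poly_ring E\<^esub> p = \<zero>\<^bsub>poly_ring E\<^esub>"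
      by (intro bexI[of _ "- p"]) (auto simp: poly_ring_def)
  qed (auto simp: poly_ring_def add_ac)
  show "comm_monoid (poly_ring E)"
  proof (rule comm_monoidI)
    fix p q assume pq: "p \<in> carrier (poly_ring E)" "q \<in> carrier (poly_ring E)"
    have "Poly_Mapping.keys k \<subseteq> E" if k: "k \<in> Poly_Mapping.keys (p * q)" for k
    proof -
      obtain m n where "k = m + n" "m \<in> Poly_Mapping.keys p" "n \<in> Poly_Mapping.keys q"
        using k Poly_Mapping.keys_mult[of p q] by blast
      with pq *[of m n] show ?thesis by (simp add: poly_ring_def) blast
    qed
    then show "p \<otimes>\<^bsub>poly_ring E\<^esub> q \<in> carrier (poly_ring E)"
      by (simp add: poly_ring_def)
  qed (auto simp: poly_ring_def mult_ac)
qed (auto simp: poly_ring_def algebra_simps)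

lemma ideal_cycle_ideal: "ideal (cycle_ideal E \<C>) (poly_ring E)"
proof -
  interpret P: cring "poly_ring E" by (rule cring_poly_ring)
  have neg: "\<ominus>\<^bsub>poly_ring E\<^esub> p = - p" if "p \<in> carrier (poly_ring E)" for p
    using that by (intro P.minus_equality) (auto simp: poly_ring_def)
  have pneg: "peval x (- p) = - peval x p" for x :: "'e \<Rightarrow> real" and p
    using peval_add[of x p "- p"] by simp
  show ?thesis
  proof (rule idealI)
    show "ring (poly_ring E)" by (rule P.ring_axioms)
    show "subgroup (cycle_ideal E \<C>) (add_monoid (poly_ring E))"
    proof (rule P.add.subgroupI)
      show "cycle_ideal E \<C> \<noteq> {}"
        using P.zero_closed by (auto simp: cycle_ideal_def poly_ring_def intro!: exI[of _ 0])
    next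
      fix a assume a: "a \<in> cycle_ideal E \<C>"
      then have "a \<in> carrier (poly_ring E)" by (simp add: cycle_ideal_def)
      with a show "\<ominus>\<^bsub>poly_ring E\<^esub> a \<in> cycle_ideal E \<C>"
        using P.a_inv_closed[of a] by (simp add: cycle_ideal_def neg pneg)
    next
      fix a b assume ab: "a \<in> cycle_ideal E \<C>" "b \<in> cycle_ideal E \<C>"
      then have "a \<oplus>\<^bsub>poly_ring E\<^esub> b \<in> carrier (poly_ring E)"
        by (auto simp: cycle_ideal_def)
      with ab show "a \<oplus>\<^bsub>poly_ring E\<^esub> b \<in> cycle_ideal E \<C>"
        by (auto simp: cycle_ideal_def poly_ring_def peval_add)
    qed (auto simp: cycle_ideal_def)
  next
    fix a b assume ab: "a \<in> cycle_ideal E \<C>" "b \<in> carrier (poly_ring E)"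
    then have "b \<otimes>\<^bsub>poly_ring E\<^esub> a \<in> carrier (poly_ring E)" "a \<otimes>\<^bsub>poly_ring E\<^esub> b \<in> carrier (poly_ring E)"
      by (auto simp: cycle_ideal_def)
    with ab show "b \<otimes>\<^bsub>poly_ring E\<^esub> a \<in> cycle_ideal E \<C>" "a \<otimes>\<^bsub>poly_ring E\<^esub> b \<in> cycle_ideal E \<C>"
      by (auto simp: cycle_ideal_def poly_ring_def peval_mult)
  qed
qed

lemma vectorspace_quotient_space:
  assumes "ideal I (poly_ring E)"
  shows "vectorspace class_ring (quotient_space E I)"
proof -
  let ?P = "poly_ring E" and ?Q = "poly_ring E Quot I"
  interpret I: ideal I ?P by (rule assms)
  interpret P: cring ?P by (rule cring_poly_ring)
  interpret Q: cring ?Q by (rule I.quotient_is_cring) (rule cring_poly_ring)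
  note hom = I.rcos_ring_hom
  have c [simp]: "Const a \<in> carrier ?P" for a by (simp add: Const_def poly_ring_def)
  have [simp]: "I +>\<^bsub>?P\<^esub> Const a \<in> carrier ?Q" for a by (rule ring_hom_closed[OF hom c])
  have add: "I +>\<^bsub>?P\<^esub> Const (a + b) = (I +>\<^bsub>?P\<^esub> Const a) \<oplus>\<^bsub>?Q\<^esub> (I +>\<^bsub>?P\<^esub> Const b)" for a b
    using ring_hom_add[OF hom c c, of a b] by (simp add: Const_def poly_ring_def single_add)
  have mult: "I +>\<^bsub>?P\<^esub> Const (a * b) = (I +>\<^bsub>?P\<^esub> Const a) \<otimes>\<^bsub>?Q\<^esub> (I +>\<^bsub>?P\<^esub> Const b)" for a b
    using ring_hom_mult[OF hom c c, of a b] by (simp add: Const_def poly_ring_def mult_single)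
  have one: "I +>\<^bsub>?P\<^esub> Const 1 = \<one>\<^bsub>?Q\<^esub>"
    using ring_hom_one[OF hom] by (simp add: Const_def poly_ring_def)
  have sel: "carrier (quotient_space E I) = carrier ?Q" "add (quotient_space E I) = add ?Q"
    "zero (quotient_space E I) = zero ?Q"
    "\<And>a X. a \<odot>\<^bsub>quotient_space E I\<^esub> X = (I +>\<^bsub>?P\<^esub> Const a) \<otimes>\<^bsub>?Q\<^esub> X"
    by (simp_all add: quotient_space_def ring.defs)
  have "Module.module (class_ring :: real ring) (quotient_space E I)"
  proof (rule moduleI)
    show "cring (class_ring :: real ring)" by (rule field.axioms(1)[THEN domain.axioms(1)]) (rule class_field)
    show "abelian_group (quotient_space E I)"
      by (rule abelian_groupI) (simp_all add: sel Q.a_ac Q.add.l_inv_ex[simplified])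
  qed (auto simp: sel add mult one Q.l_distr Q.r_distr Q.m_assoc)
  then show ?thesis by (intro vectorspace.intro class_field)
qed

section \<open>Generation can fail without \<^const>\<open>cosimple\<close>\<close>

lemma generators_fail_without_cosimple:
  defines "E \<equiv> {0, 1, 2 :: nat}"
  defines "\<C> \<equiv> {{}, E}"
  shows "binary_matroid E \<C>"
    and "Idl\<^bsub>poly_ring E\<^esub> (cycle_generators E \<C>) \<noteq> cycle_ideal E \<C>"
proof -
  show "binary_matroid E \<C>"
    by unfold_locales (auto simp: E_def \<C>_def)
  have cocycles: "cocycles E \<C> = {{}, {0, 1}, {0, 2}, {1, 2}}"
  proof (intro equalityI subsetI)
    fix D assume "D \<in> cocycles E \<C>"
    then have sub: "D \<subseteq> E" and "even (card (D \<inter> E))"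
      by (auto simp: cocycles_def \<C>_def)
    then have ev: "even (card D)"
      by (simp add: Int_absorb2)
    have D: "D = (if 0 \<in> D then {0} else {}) \<union> (if 1 \<in> D then {1} else {}) \<union>
        (if 2 \<in> D then {2} else {})" (is "D = ?D")
      using sub unfolding E_def by auto
    from ev have "even (card ?D)"
      using arg_cong[OF D, of card] by (simp only:)
    then have "?D \<in> {{}, {0, 1}, {0, 2}, {1, 2}}"
      by (cases "0 \<in> D"; cases "1 \<in> D"; cases "2 \<in> D") (simp_all add: insert_commute)
    then show "D \<in> {{}, {0, 1}, {0, 2}, {1, 2}}"
      by (subst D)
  next
    fix D :: "nat set" assume "D \<in> {{}, {0, 1}, {0, 2}, {1, 2}}"
    then consider "D = {}" | "D = {0, 1}" | "D = {0, 2}" | "D = {1, 2}" by blast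
    then show "D \<in> cocycles E \<C>"
      by cases (simp_all add: cocycles_def \<C>_def E_def)
  qed
  have no_gens: "\<not> (D \<in> cocircuits E \<C> \<and> chordless E \<C> D)" for D
  proof
    assume D: "D \<in> cocircuits E \<C> \<and> chordless E \<C> D"
    then have "D = {0, 1} \<or> D = {0, 2} \<or> D = {1, 2}"
      by (auto simp: cocircuits_def cocycles)
    moreover have "is_chord E \<C> {0, 1} 2"
      unfolding is_chord_def cocycles
      by (intro conjI bexI[of _ "{0, 2}"] bexI[of _ "{1, 2}"]) (auto simp: E_def)
    moreover have "is_chord E \<C> {0, 2} 1"
      unfolding is_chord_def cocycles
      by (intro conjI bexI[of _ "{0, 1}"] bexI[of _ "{1, 2}"]) (auto simp: E_def)
    moreover have "is_chord E \<C> {1, 2} 0"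
      unfolding is_chord_def cocycles
      by (intro conjI bexI[of _ "{0, 1}"] bexI[of _ "{0, 2}"]) (auto simp: E_def)
    ultimately show False using D by (auto simp: chordless_def)
  qed
  interpret P: cring "poly_ring E" by (rule cring_poly_ring)
  have Var: "Var e \<in> carrier (poly_ring E)" if "e \<in> E" for e
    using that by (simp add: Var_def poly_ring_def)
  have Var2: "Var e * Var f \<in> carrier (poly_ring E)" if "e \<in> E" "f \<in> E" for e f
    using P.m_closed[OF Var[OF that(1)] Var[OF that(2)]] by (simp add: poly_ring_def)
  have minus: "p - q \<in> carrier (poly_ring E)"
    if "p \<in> carrier (poly_ring E)" "q \<in> carrier (poly_ring E)" for p q
    using that Poly_Mapping.keys_diff[of p q] by (auto simp: poly_ring_def)
  have one: "1 \<in> carrier (poly_ring E)"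
    using P.one_closed by (simp add: poly_ring_def)
  have ev_Var: "peval x (Var e) = x e" for x :: "nat \<Rightarrow> real" and e
    by (simp add: Var_def peval_single)
  have ev_one: "peval x 1 = 1" for x :: "nat \<Rightarrow> real"
    using peval_single[of x 0 1] by simp
  have ev_minus: "peval x (p - q) = peval x p - peval x q" for x :: "nat \<Rightarrow> real" and p q
    using peval_add[of x "p - q" q] by simp
  note ev = ev_Var ev_one ev_minus peval_mult power2_eq_square
  have "cycle_generators E \<C> \<subseteq> cycle_ideal E {{0}}"
    using no_gens
    by (auto simp: cycle_generators_def cycle_ideal_def ev cycle_vector_def intro!: minus one Var2)
  then have "Idl\<^bsub>poly_ring E\<^esub> (cycle_generators E \<C>) \<subseteq> cycle_ideal E {{0}}"
    by (intro P.genideal_minimal ideal_cycle_ideal)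
  moreover have "1 - Var 0 * Var 1 \<in> cycle_ideal E \<C>"
    using minus[OF one Var2[of 0 1]]
    by (auto simp: cycle_ideal_def ev cycle_vector_def \<C>_def E_def)
  moreover have "1 - Var 0 * Var 1 \<notin> cycle_ideal E {{0}}"
    by (auto simp: cycle_ideal_def ev cycle_vector_def)
  ultimately show "Idl\<^bsub>poly_ring E\<^esub> (cycle_generators E \<C>) \<noteq> cycle_ideal E \<C>"
    by blast
qed

end

theory Submission
  imports Defs
begin

text \<open>
  On the finite group \<open>\<C>\<close>, with symmetric difference as addition, the monomial \<open>x\<^sup>F\<close> evaluates at
  the cycle vectors to the character \<open>C \<mapsto> (-1)\<^bsup>|F \<inter> C|\<^esup>\<close>, and two such characters agree exactly when
  \<open>F \<Delta> F'\<close> is a cocycle. Distinct characters are orthogonal, so the monomials of representatives are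
  independent modulo the cycle ideal. Conversely, \<open>x\<^sub>e\<^sup>2 \<equiv> 1\<close> and \<open>x\<^sup>D \<equiv> 1\<close> for all cocycles \<open>D\<close> suffice
  to rewrite every polynomial into a combination of these monomials; hence they also generate the
  ideal. To obtain \<open>x\<^sup>D \<equiv> 1\<close> from the chordless cocircuits, induct on the size of \<open>D\<close>: a cocycle
  that is not a cocircuit splits into two smaller ones, and a chord \<open>e\<close> with \<open>A \<inter> B = {e}\<close>,
  \<open>D = A \<Delta> B\<close> gives \<open>x\<^sup>A x\<^sup>B = x\<^sub>e\<^sup>2 x\<^sup>D\<close>. Here \<open>|A| + |B| = |D| + 2\<close>, and in the cosimple case both
  summands are at least three, so \<open>A\<close> and \<open>B\<close> are smaller than \<open>D\<close>.
\<close>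

section \<open>Symmetric differences and cocycles\<close>

lemma even_card_sym_diff:
  assumes "finite A" "finite B"
  shows "even (card (sym_diff A B)) \<longleftrightarrow> (even (card A) \<longleftrightarrow> even (card B))"
proof -
  have "card (sym_diff A B) = card (A - B) + card (B - A)"
    using assms by (intro card_Un_disjoint) auto
  moreover have "card A = card (A - B) + card (A \<inter> B)"
    using assms by (subst card_Un_disjoint[symmetric]) (auto intro: arg_cong[where f = card])
  moreover have "card B = card (B - A) + card (A \<inter> B)"
    using assms by (subst card_Un_disjoint[symmetric]) (auto intro: arg_cong[where f = card])
  ultimately show ?thesis by presburger
qed

lemma neg_one_power_card_sym_diff:
  assumes "finite A" "finite B"
  shows "(- 1 :: 'a :: ring_1) ^ card (sym_diff A B) = (- 1) ^ card A * (- 1) ^ card B"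
  using even_card_sym_diff[OF assms] by (simp add: minus_one_power_iff)

lemma sym_diff_Int_distrib: "sym_diff A B \<inter> C = sym_diff (A \<inter> C) (B \<inter> C)"
  by blast

lemma cocycles_sym_diff:
  assumes "finite E" "A \<in> cocycles E \<C>" "B \<in> cocycles E \<C>"
  shows "sym_diff A B \<in> cocycles E \<C>"
proof -
  have "finite A" "finite B"
    using assms by (auto simp: cocycles_def intro: finite_subset)
  then show ?thesis
    using assms by (auto simp: cocycles_def sym_diff_Int_distrib even_card_sym_diff)
qed

lemma empty_cocycle: "{} \<in> cocycles E \<C>"
  by (simp add: cocycles_def)

lemma exists_cocircuit_subset:
  assumes "finite E" "D \<in> cocycles E \<C>" "D \<noteq> {}"
  obtains D' where "D' \<in> cocircuits E \<C>" "D' \<subseteq> D"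
proof -
  have "finite D" using assms by (auto simp: cocycles_def intro: finite_subset)
  then have "finite {D' \<in> cocycles E \<C>. D' \<noteq> {} \<and> D' \<subseteq> D}"
    by (rule rev_finite_subset[OF finite_Pow_iff[THEN iffD2]]) auto
  from finite_has_minimal2[OF this, of D] assms(2,3) obtain M where
    M: "M \<in> {D' \<in> cocycles E \<C>. D' \<noteq> {} \<and> D' \<subseteq> D}" and
    min: "\<forall>X\<in>{D' \<in> cocycles E \<C>. D' \<noteq> {} \<and> D' \<subseteq> D}. X \<subseteq> M \<longrightarrow> M = X"
    by (metis (mono_tags, lifting) mem_Collect_eq subset_refl)
  \<comment> \<open>Any cocycle inside \<open>M\<close> also lies in \<open>D\<close>, so minimality
    below \<open>D\<close> is minimality among all nonempty cocycles.\<close>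
  have "M \<in> cocircuits E \<C>" "M \<subseteq> D"
    unfolding cocircuits_def using M min by blast+
  then show ?thesis by (rule that)
qed

text \<open>A nonempty cocycle contains a cocircuit, so the bound passes up. It is needed in this
  form because the two cocycles that witness a chord need not be cocircuits.\<close>

lemma cosimple_card_cocycle:
  assumes "finite E" "cosimple E \<C>" "D \<in> cocycles E \<C>" "D \<noteq> {}"
  shows "3 \<le> card D"
proof -
  obtain D' where D': "D' \<in> cocircuits E \<C>" "D' \<subseteq> D"
    using exists_cocircuit_subset assms by metis
  have "finite D" using assms by (auto simp: cocycles_def intro: finite_subset)
  then have "card D' \<le> card D" using D' by (intro card_mono)
  moreover have "3 \<le> card D'" using assms D' by (auto simp: cosimple_def)
  ultimately show ?thesis by simp
qed

section \<open>Square-free monomials modulo an ideal\<close>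

lemma poly_ring_simps [simp]:
  "mult (poly_ring E) = (*)" "one (poly_ring E) = 1"
  "zero (poly_ring E) = 0" "add (poly_ring E) = (+)"
  by (simp_all add: poly_ring_def)

lemma Const_in_poly_ring [simp]: "Const c \<in> carrier (poly_ring E)"
  by (simp add: Const_def poly_ring_def)

lemma Var_in_poly_ring [simp]: "e \<in> E \<Longrightarrow> Var e \<in> carrier (poly_ring E)"
  by (simp add: Var_def poly_ring_def)

lemma one_in_poly_ring [simp]: "1 \<in> carrier (poly_ring E)"
  by (simp add: poly_ring_def)

lemma zero_in_poly_ring [simp]: "0 \<in> carrier (poly_ring E)"
  by (simp add: poly_ring_def)

lemma uminus_in_poly_ring [simp]:
  "p \<in> carrier (poly_ring E) \<Longrightarrow> - p \<in> carrier (poly_ring E)"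
  by (simp add: poly_ring_def)

lemma add_in_poly_ring [simp]:
  assumes "p \<in> carrier (poly_ring E)" "q \<in> carrier (poly_ring E)"
  shows "p + q \<in> carrier (poly_ring E)"
proof -
  interpret P: cring "poly_ring E" by (rule cring_poly_ring)
  show ?thesis using P.a_closed[OF assms] by simp
qed

lemma diff_in_poly_ring [simp]:
  "p \<in> carrier (poly_ring E) \<Longrightarrow> q \<in> carrier (poly_ring E) \<Longrightarrow> p - q \<in> carrier (poly_ring E)"
  using add_in_poly_ring[of p E "- q"] by simp

lemma mult_in_poly_ring [simp]:
  assumes "p \<in> carrier (poly_ring E)" "q \<in> carrier (poly_ring E)"
  shows "p * q \<in> carrier (poly_ring E)"
proof -
  interpret P: cring "poly_ring E" by (rule cring_poly_ring)
  show ?thesis using P.m_closed[OF assms] by simp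
qed

lemma power_in_poly_ring [simp]:
  "p \<in> carrier (poly_ring E) \<Longrightarrow> p ^ n \<in> carrier (poly_ring E)"
  by (induction n) auto

lemma sum_in_poly_ring:
  "(\<And>i. i \<in> A \<Longrightarrow> f i \<in> carrier (poly_ring E)) \<Longrightarrow> sum f A \<in> carrier (poly_ring E)"
  by (induction A rule: infinite_finite_induct) auto

lemma prod_in_poly_ring:
  "(\<And>i. i \<in> A \<Longrightarrow> f i \<in> carrier (poly_ring E)) \<Longrightarrow> prod f A \<in> carrier (poly_ring E)"
  by (induction A rule: infinite_finite_induct) auto

lemma monom_set_in_poly_ring [simp]:
  "F \<subseteq> E \<Longrightarrow> monom_set F \<in> carrier (poly_ring E)"
  unfolding monom_set_def by (intro prod_in_poly_ring) auto

lemma a_minus_poly_ring: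
  assumes "p \<in> carrier (poly_ring E)" "q \<in> carrier (poly_ring E)"
  shows "p \<ominus>\<^bsub>poly_ring E\<^esub> q = p - q"
proof -
  interpret P: cring "poly_ring E" by (rule cring_poly_ring)
  have "\<ominus>\<^bsub>poly_ring E\<^esub> q = - q"
    using assms by (intro P.minus_equality) auto
  then show ?thesis by (simp add: a_minus_def)
qed

section \<open>Products of square-free monomials; terms as products of variables\<close>

lemma monom_set_empty [simp]: "monom_set {} = 1"
  by (simp add: monom_set_def)

lemma monom_set_Un_disjoint:
  "finite A \<Longrightarrow> finite B \<Longrightarrow> A \<inter> B = {} \<Longrightarrow> monom_set (A \<union> B) = monom_set A * monom_set B"
  by (simp add: monom_set_def prod.union_disjoint)

text \<open>Common variables occur squared. Once squares are congruent to 1, multiplying monomials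
  therefore amounts to taking symmetric differences.\<close>

lemma monom_set_mult:
  assumes "finite A" "finite B"
  shows "monom_set A * monom_set B = monom_set (sym_diff A B) * monom_set (A \<inter> B) ^ 2"
proof -
  have "monom_set A = monom_set (A - B) * monom_set (A \<inter> B)"
    using assms by (subst monom_set_Un_disjoint[symmetric]) (auto intro: arg_cong[where f = monom_set])
  moreover have "monom_set B = monom_set (B - A) * monom_set (A \<inter> B)"
    using assms by (subst monom_set_Un_disjoint[symmetric]) (auto intro: arg_cong[where f = monom_set])
  moreover have "monom_set (sym_diff A B) = monom_set (A - B) * monom_set (B - A)"
    using assms by (intro monom_set_Un_disjoint) auto
  ultimately show ?thesis by (simp add: power2_eq_square mult_ac)
qed

lemma Var_power: "Var e ^ n = Poly_Mapping.single (Poly_Mapping.single e n) 1"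
proof (induction n)
  case (Suc n)
  then show ?case by (simp add: Var_def mult_single flip: single_add)
qed simp

lemma prod_single_one:
  "(\<Prod>e\<in>A. Poly_Mapping.single (f e) (1 :: real)) = Poly_Mapping.single (\<Sum>e\<in>A. f e) 1"
  by (induction A rule: infinite_finite_induct) (auto simp: mult_single)

text \<open>Used at two levels: for exponent vectors, to split a monomial into powers of variables,
  and for polynomials, to split them into terms.\<close>

lemma sum_single_lookup:
  "(\<Sum>m\<in>Poly_Mapping.keys p. Poly_Mapping.single m (Poly_Mapping.lookup p m)) = p"
  by (rule poly_mapping_eqI) (auto simp: lookup_sum lookup_single when_def in_keys_iff)

lemma single_eq_prod_Var:
  "Poly_Mapping.single m c = Const c * (\<Prod>e\<in>Poly_Mapping.keys m. Var e ^ Poly_Mapping.lookup m e)"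
  by (simp add: Var_power prod_single_one Const_def mult_single sum_single_lookup)

section \<open>Congruence modulo an ideal, written \<open>p - q \<in> I\<close>\<close>

locale poly_ideal =
  fixes E :: "'e set" and I :: "'e rpoly set"
  assumes ideal_I: "ideal I (poly_ring E)"
begin

sublocale ideal I "poly_ring E" by (rule ideal_I)

lemma mem_poly_ring: "p \<in> I \<Longrightarrow> p \<in> carrier (poly_ring E)"
  by (rule a_Hcarr)

lemma zero_mem: "0 \<in> I"
  using additive_subgroup.zero_closed[OF is_additive_subgroup] by simp

lemma add_mem: "p \<in> I \<Longrightarrow> q \<in> I \<Longrightarrow> p + q \<in> I"
  using additive_subgroup.a_closed[OF is_additive_subgroup, of p q] by simp

lemma mult_mem: "p \<in> carrier (poly_ring E) \<Longrightarrow> q \<in> I \<Longrightarrow> p * q \<in> I"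
  using I_l_closed[of q p] by simp

lemma uminus_mem: "p \<in> I \<Longrightarrow> - p \<in> I"
  using mult_mem[of "- 1" p] by simp

lemma diff_mem: "p \<in> I \<Longrightarrow> q \<in> I \<Longrightarrow> p - q \<in> I"
  using add_mem[of p "- q"] uminus_mem by simp

lemma diff_mem_commute: "p - q \<in> I \<Longrightarrow> q - p \<in> I"
  using uminus_mem[of "p - q"] by simp

lemma diff_mem_trans: "p - q \<in> I \<Longrightarrow> q - r \<in> I \<Longrightarrow> p - r \<in> I"
  using add_mem[of "p - q" "q - r"] by simp

text \<open>Congruences multiply because the difference equals
  \<open>p' * (p - q) + q * (p' - q')\<close>; the multipliers \<open>p'\<close> and
  \<open>q\<close> have to lie in the ring.\<close>

lemma diff_mult_mem:
  assumes "p - q \<in> I" "p' - q' \<in> I" "p' \<in> carrier (poly_ring E)" "q \<in> carrier (poly_ring E)"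
  shows "p * p' - q * q' \<in> I"
proof -
  have "p' * (p - q) + q * (p' - q') \<in> I"
    using assms by (intro add_mem mult_mem)
  then show ?thesis by (simp add: algebra_simps)
qed

lemma sum_diff_mem:
  "(\<And>i. i \<in> A \<Longrightarrow> f i - g i \<in> I) \<Longrightarrow> sum f A - sum g A \<in> I"
proof (induction A rule: infinite_finite_induct)
  case (insert i A)
  then have "(f i - g i) + (sum f A - sum g A) \<in> I" by (intro add_mem) auto
  with insert(1,2) show ?case by (simp add: algebra_simps)
qed (auto simp: zero_mem)

lemma coset_eq_iff:
  assumes "p \<in> carrier (poly_ring E)" "q \<in> carrier (poly_ring E)"
  shows "I +>\<^bsub>poly_ring E\<^esub> p = I +>\<^bsub>poly_ring E\<^esub> q \<longleftrightarrow> p - q \<in> I"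
  using quotient_eq_iff_same_a_r_cos[OF ideal_I assms]
  by (simp add: a_minus_poly_ring assms)

end

text \<open>An intermediate stage: the generated ideal contains these squares at once, and they help
  to derive \<open>1 - monom_set D\<close> for all cocycles \<open>D\<close>.\<close>

locale square_ideal = poly_ideal +
  assumes Var_square: "e \<in> E \<Longrightarrow> Var e ^ 2 - 1 \<in> I"
begin

text \<open>Induction in steps of two: splitting off \<open>Var e ^ 2\<close>, which is congruent to
  1, keeps the parity of the exponent.\<close>

lemma Var_power_mem:
  assumes "e \<in> E"
  shows "Var e ^ n - (if odd n then Var e else 1) \<in> I"
proof (induction n rule: induct_nat_012)
  case (ge2 n)
  have "Var e ^ 2 * Var e ^ n - 1 * (if odd n then Var e else 1) \<in> I"
    using ge2 assms by (intro diff_mult_mem Var_square) auto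
  then show ?case by (simp add: power2_eq_square mult.assoc)
qed (auto simp: zero_mem)

lemma prod_Var_power_mem:
  assumes "finite A" "A \<subseteq> E"
  shows "(\<Prod>e\<in>A. Var e ^ k e) - monom_set {e \<in> A. odd (k e)} \<in> I"
  using assms
proof (induction A)
  case (insert e A)
  have "(\<Prod>e\<in>insert e A. Var e ^ k e) = Var e ^ k e * (\<Prod>e\<in>A. Var e ^ k e)"
    using insert by simp
  moreover have "monom_set {x \<in> insert e A. odd (k x)} =
      (if odd (k e) then Var e else 1) * monom_set {e \<in> A. odd (k e)}"
  proof -
    have "{x \<in> insert e A. odd (k x)} = (if odd (k e) then insert e {e \<in> A. odd (k e)} else {e \<in> A. odd (k e)})"
      by auto
    then show ?thesis using insert by (simp add: monom_set_def)
  qed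
  moreover have "Var e ^ k e * (\<Prod>e\<in>A. Var e ^ k e) -
      (if odd (k e) then Var e else 1) * monom_set {e \<in> A. odd (k e)} \<in> I"
    using insert by (intro diff_mult_mem Var_power_mem prod_in_poly_ring) auto
  ultimately show ?case by (simp only:)
qed (simp add: zero_mem)

lemma monom_set_square_mem:
  assumes "finite F" "F \<subseteq> E"
  shows "monom_set F ^ 2 - 1 \<in> I"
  \<comment> \<open>With all exponents equal to 2, no exponent is odd and the reduced monomial is
    1.\<close>
  using prod_Var_power_mem[OF assms, of "\<lambda>_. 2"] by (simp add: monom_set_def prod_power_distrib)

end

section \<open>Normal forms\<close>

text \<open>Interpreted twice: normal forms modulo the cycle ideal show that the cosets span, and
  normal forms modulo the generated ideal show that it is large enough.\<close>

locale cocycle_ideal = square_ideal E I + binary_matroid E \<C>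
  for E :: "'e set" and I :: "'e rpoly set" and \<C> :: "'e set set" +
  assumes cocycle_mem: "D \<in> cocycles E \<C> \<Longrightarrow> 1 - monom_set D \<in> I"
begin

lemma monom_set_cocycle_rel_mem:
  assumes "F \<subseteq> E" "G \<subseteq> E" "sym_diff F G \<in> cocycles E \<C>"
  shows "monom_set F - monom_set G \<in> I"
proof -
  let ?D = "sym_diff F G"
  have fin: "finite F" "finite G" using assms finite_ground by (auto intro: finite_subset)
  have "monom_set ?D * monom_set (F \<inter> G) ^ 2 - 1 * 1 \<in> I"
    using assms fin
    by (intro diff_mult_mem diff_mem_commute[OF cocycle_mem] monom_set_square_mem
        power_in_poly_ring monom_set_in_poly_ring) auto
  then have *: "monom_set F * monom_set G - 1 \<in> I"
    using fin by (simp add: monom_set_mult)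
  \<comment> \<open>The two terms containing \<open>monom_set G ^ 2\<close> cancel, which leaves
    \<open>monom_set F - monom_set G\<close>.\<close>
  have "monom_set G * (monom_set F * monom_set G - 1) - monom_set F * (monom_set G ^ 2 - 1) \<in> I"
    by (rule diff_mem[OF mult_mem[OF _ *] mult_mem[OF _ monom_set_square_mem]])
      (use assms fin in auto)
  then show ?thesis by (simp add: algebra_simps power2_eq_square)
qed

text \<open>Each term is reduced to its square-free part, given by the odd exponents, and this part
  is replaced by the representative of its class.\<close>

lemma exists_normal_form:
  assumes \<F>: "distinct_representatives (Pow E) (cocycle_rel E \<C>) \<F>"
    and p: "p \<in> carrier (poly_ring E)"
  obtains a where "p - (\<Sum>G\<in>\<F>. Const (a G) * monom_set G) \<in> I"
proof -
  have \<F>_sub: "\<F> \<subseteq> Pow E" using \<F> by (simp add: distinct_representatives_def)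
  have fin\<F>: "finite \<F>" using \<F>_sub finite_ground by (meson finite_Pow_iff finite_subset)
  have rep: "\<exists>G\<in>\<F>. sym_diff F G \<in> cocycles E \<C>" if "F \<subseteq> E" for F
  proof -
    have "cocycle_rel E \<C> `` {F} \<in> Pow E // cocycle_rel E \<C>"
      using that by (intro quotientI) auto
    then obtain G where "G \<in> \<F>" "G \<in> cocycle_rel E \<C> `` {F}"
      using \<F> by (auto simp: distinct_representatives_def)
    then show ?thesis by (auto simp: cocycle_rel_def)
  qed
  let ?k = "Poly_Mapping.keys p"
  let ?odd = "\<lambda>m. {e \<in> Poly_Mapping.keys m. odd (Poly_Mapping.lookup m e)}"
  have keys: "Poly_Mapping.keys m \<subseteq> E" if "m \<in> ?k" for m
    using p that by (auto simp: poly_ring_def)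
  have "\<forall>m\<in>?k. \<exists>G. G \<in> \<F> \<and> sym_diff (?odd m) G \<in> cocycles E \<C>"
  proof
    fix m assume "m \<in> ?k"
    then have "?odd m \<subseteq> E" using keys by blast
    from rep[OF this] show "\<exists>G. G \<in> \<F> \<and> sym_diff (?odd m) G \<in> cocycles E \<C>"
      unfolding Bex_def .
  qed
  from bchoice[OF this] obtain g where
    "\<forall>m\<in>?k. g m \<in> \<F> \<and> sym_diff (?odd m) (g m) \<in> cocycles E \<C>" by (rule exE)
  then have g: "g m \<in> \<F>" "sym_diff (?odd m) (g m) \<in> cocycles E \<C>" if "m \<in> ?k" for m
    using that by simp_all
  let ?c = "Poly_Mapping.lookup p"
  \<comment> \<open>Several terms may end at the same representative, so their coefficients are
    added up.\<close>
  let ?a = "\<lambda>G. \<Sum>m | m \<in> ?k \<and> g m = G. ?c m"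
  have "Poly_Mapping.single m (?c m) - Const (?c m) * monom_set (g m) \<in> I" if m: "m \<in> ?k" for m
  proof -
    have "(\<Prod>e\<in>Poly_Mapping.keys m. Var e ^ Poly_Mapping.lookup m e) - monom_set (?odd m) \<in> I"
      using keys[OF m] by (intro prod_Var_power_mem) auto
    moreover have "monom_set (?odd m) - monom_set (g m) \<in> I"
      using keys[OF m] g[OF m] \<F>_sub by (intro monom_set_cocycle_rel_mem) auto
    ultimately have "(\<Prod>e\<in>Poly_Mapping.keys m. Var e ^ Poly_Mapping.lookup m e) - monom_set (g m) \<in> I"
      by (rule diff_mem_trans)
    from mult_mem[OF _ this, of "Const (?c m)"] show ?thesis
      by (subst single_eq_prod_Var) (simp add: right_diff_distrib)
  qed
  then have "(\<Sum>m\<in>?k. Poly_Mapping.single m (?c m)) - (\<Sum>m\<in>?k. Const (?c m) * monom_set (g m)) \<in> I"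
    by (rule sum_diff_mem)
  moreover have "(\<Sum>m\<in>?k. Const (?c m) * monom_set (g m)) = (\<Sum>G\<in>\<F>. Const (?a G) * monom_set G)"
  proof -
    have Const_sum: "Const (sum f A) = (\<Sum>i\<in>A. Const (f i))" for f :: "('e \<Rightarrow>\<^sub>0 nat) \<Rightarrow> real" and A
      by (induction A rule: infinite_finite_induct) (auto simp: Const_def single_add)
    have "(\<Sum>m\<in>?k. Const (?c m) * monom_set (g m)) =
        (\<Sum>G\<in>\<F>. \<Sum>m | m \<in> ?k \<and> g m = G. Const (?c m) * monom_set (g m))"
      using g(1) fin\<F> by (intro sum.group[symmetric]) auto
    also have "\<dots> = (\<Sum>G\<in>\<F>. Const (?a G) * monom_set G)"
      by (intro sum.cong) (auto simp: Const_sum sum_distrib_right)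
    finally show ?thesis .
  qed
  ultimately show ?thesis
    using that[of ?a] by (simp add: sum_single_lookup)
qed

end

section \<open>Evaluation at cycle vectors\<close>

lemma peval_Const [simp]: "peval x (Const c) = c"
  by (simp add: Const_def peval_single)

lemma peval_Var [simp]: "peval x (Var e) = x e"
  by (simp add: Var_def peval_single)

lemma peval_one [simp]: "peval x 1 = 1"
  using peval_single[of x 0 1] by simp

lemma peval_diff: "peval x (p - q) = peval x p - peval x q"
  using peval_add[of x "p - q" q] by simp

lemma peval_sum: "peval x (sum f A) = (\<Sum>i\<in>A. peval x (f i))"
  by (induction A rule: infinite_finite_induct) (auto simp: peval_add)

lemma peval_prod: "peval x (prod f A) = (\<Prod>i\<in>A. peval x (f i))"
  by (induction A rule: infinite_finite_induct) (auto simp: peval_mult)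

lemma peval_cycle_vector_monom_set:
  assumes "finite F"
  shows "peval (cycle_vector C) (monom_set F) = (- 1) ^ card (F \<inter> C)"
proof -
  have "(\<Prod>e\<in>F. cycle_vector C e) = (\<Prod>e\<in>F \<inter> C. - 1)"
    by (subst prod.inter_restrict[OF assms]) (auto simp: cycle_vector_def intro!: prod.cong)
  then show ?thesis by (simp add: monom_set_def peval_prod)
qed

section \<open>Orthogonality of the characters of the group of cycles\<close>

context binary_matroid
begin

lemma finite_cycles: "finite \<C>"
  using cycles_subset finite_ground by (meson finite_Pow_iff finite_subset)

text \<open>Some cycle \<open>C0\<close> meets \<open>G\<close> in an odd number of elements.
  Translation by \<open>C0\<close> permutes the cycles and flips every sign, so the sum equals its
  own negative.\<close>

lemma sum_character_eq_0:
  assumes "G \<subseteq> E" "G \<notin> cocycles E \<C>"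
  shows "(\<Sum>C\<in>\<C>. (- 1 :: real) ^ card (G \<inter> C)) = 0"
proof -
  obtain C0 where C0: "C0 \<in> \<C>" "odd (card (G \<inter> C0))"
    using assms by (auto simp: cocycles_def)
  have cancel: "sym_diff (sym_diff C C0) C0 = C" for C by blast
  let ?s = "\<Sum>C\<in>\<C>. (- 1 :: real) ^ card (G \<inter> C)"
  have fin: "finite G" using assms finite_ground by (auto intro: finite_subset)
  have "?s = (\<Sum>C\<in>\<C>. (- 1 :: real) ^ card (G \<inter> sym_diff C C0))"
    by (rule sum.reindex_bij_witness[of _ "\<lambda>C. sym_diff C C0" "\<lambda>C. sym_diff C C0"])
      (simp_all only: cancel cycles_sym_diff C0)
  also have "\<dots> = (\<Sum>C\<in>\<C>. - ((- 1 :: real) ^ card (G \<inter> C)))"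
  proof (rule sum.cong)
    fix C assume "C \<in> \<C>"
    have "G \<inter> sym_diff C C0 = sym_diff (G \<inter> C) (G \<inter> C0)" by blast
    then show "(- 1 :: real) ^ card (G \<inter> sym_diff C C0) = - ((- 1) ^ card (G \<inter> C))"
      using neg_one_power_card_sym_diff[of "G \<inter> C" "G \<inter> C0", where 'a = real] fin C0
      by (simp only: finite_Int) simp
  qed simp
  also have "\<dots> = - ?s" by (simp add: sum_negf)
  finally show ?thesis by simp
qed

text \<open>Summing the vanishing values against the character of \<open>G\<close> over all cycles
  leaves \<open>a G * card \<C>\<close>, by orthogonality.\<close>

lemma characters_independent:
  fixes a :: "'e set \<Rightarrow> real"
  assumes \<F>: "distinct_representatives (Pow E) (cocycle_rel E \<C>) \<F>"
    and zero: "(\<Sum>F\<in>\<F>. Const (a F) * monom_set F) \<in> cycle_ideal E \<C>"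
    and G: "G \<in> \<F>"
  shows "a G = 0"
proof -
  have \<F>_sub: "\<F> \<subseteq> Pow E" using \<F> by (simp add: distinct_representatives_def)
  have fin\<F>: "finite \<F>" using \<F>_sub finite_ground by (meson finite_Pow_iff finite_subset)
  have fin: "finite F" if "F \<in> \<F>" for F
    using that \<F>_sub finite_ground by (auto intro: finite_subset)
  \<comment> \<open>Otherwise the class of \<open>G\<close> would contain two
    representatives.\<close>
  have ineq: "sym_diff F G \<notin> cocycles E \<C>" if F: "F \<in> \<F>" "F \<noteq> G" for F
  proof
    assume "sym_diff F G \<in> cocycles E \<C>"
    then have "F \<in> cocycle_rel E \<C> `` {G}" "G \<in> cocycle_rel E \<C> `` {G}"
      using F G \<F>_sub by (auto simp: cocycle_rel_def empty_cocycle Un_commute)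
    moreover have "cocycle_rel E \<C> `` {G} \<in> Pow E // cocycle_rel E \<C>"
      using G \<F>_sub by (intro quotientI) auto
    then have "\<exists>!H. H \<in> \<F> \<and> H \<in> cocycle_rel E \<C> `` {G}"
      using \<F> by (simp only: distinct_representatives_def)
    ultimately show False
      using F G by (elim ex1E) metis
  qed
  let ?\<chi> = "\<lambda>F C. (- 1 :: real) ^ card (F \<inter> C)"
  have vanish: "(\<Sum>F\<in>\<F>. a F * ?\<chi> F C) = 0" if "C \<in> \<C>" for C
  proof -
    have "0 = peval (cycle_vector C) (\<Sum>F\<in>\<F>. Const (a F) * monom_set F)"
      using zero that by (auto simp: cycle_ideal_def)
    also have "\<dots> = (\<Sum>F\<in>\<F>. a F * ?\<chi> F C)"
      by (simp add: peval_sum peval_mult peval_cycle_vector_monom_set fin)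
    finally show ?thesis by simp
  qed
  have orth: "(\<Sum>C\<in>\<C>. ?\<chi> F C * ?\<chi> G C) = (if F = G then card \<C> else 0)" if F: "F \<in> \<F>" for F
  proof -
    \<comment> \<open>Characters multiply along symmetric differences, so orthogonality reduces to
      the sum of a single character.\<close>
    have "?\<chi> F C * ?\<chi> G C = ?\<chi> (sym_diff F G) C" for C
      using fin F G by (subst sym_diff_Int_distrib, subst neg_one_power_card_sym_diff) auto
    then have "(\<Sum>C\<in>\<C>. ?\<chi> F C * ?\<chi> G C) = (\<Sum>C\<in>\<C>. ?\<chi> (sym_diff F G) C)"
      by simp
    also have "\<dots> = (if F = G then card \<C> else 0)"
    proof (cases "F = G")
      case False
      have "(\<Sum>C\<in>\<C>. ?\<chi> (sym_diff F G) C) = 0"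
        using F G \<F>_sub False by (intro sum_character_eq_0 ineq) auto
      with False show ?thesis by simp
    qed simp
    finally show ?thesis .
  qed
  have "0 = (\<Sum>C\<in>\<C>. (\<Sum>F\<in>\<F>. a F * ?\<chi> F C) * ?\<chi> G C)"
    using vanish by simp
  also have "\<dots> = (\<Sum>F\<in>\<F>. a F * (\<Sum>C\<in>\<C>. ?\<chi> F C * ?\<chi> G C))"
    unfolding sum_distrib_left sum_distrib_right by (subst sum.swap) (simp add: mult_ac)
  also have "\<dots> = (\<Sum>F\<in>\<F>. if F = G then a F * card \<C> else 0)"
    by (intro sum.cong) (auto simp: orth)
  also have "\<dots> = a G * card \<C>"
    using fin\<F> G by simp
  finally show ?thesis
    using cycles_nonempty finite_cycles by simp
qed

text \<open>Cycle vectors have entries 1 and -1, so squares evaluate to 1; a cocycle meets each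
  cycle evenly, so its monomial also evaluates to 1.\<close>

lemma cocycle_ideal_cycle_ideal: "cocycle_ideal E (cycle_ideal E \<C>) \<C>"
proof (intro cocycle_ideal.intro square_ideal.intro poly_ideal.intro
    square_ideal_axioms.intro cocycle_ideal_axioms.intro)
  show "ideal (cycle_ideal E \<C>) (poly_ring E)" by (rule ideal_cycle_ideal)
  show "binary_matroid E \<C>" by (rule binary_matroid_axioms)
next
  fix e assume "e \<in> E"
  then show "Var e ^ 2 - 1 \<in> cycle_ideal E \<C>"
    by (auto simp: cycle_ideal_def power2_eq_square peval_diff peval_mult cycle_vector_def)
next
  fix D assume D: "D \<in> cocycles E \<C>"
  then have "D \<subseteq> E" "finite D" using finite_ground by (auto simp: cocycles_def intro: finite_subset)
  then show "1 - monom_set D \<in> cycle_ideal E \<C>"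
    using D by (auto simp: cycle_ideal_def peval_diff peval_cycle_vector_monom_set cocycles_def)
qed

end

section \<open>The generated ideal\<close>

lemma (in square_ideal) cocycle_mem_of_chordless:
  assumes "binary_matroid E \<C>" "cosimple E \<C>"
    and gen: "\<And>D. D \<in> cocircuits E \<C> \<Longrightarrow> chordless E \<C> D \<Longrightarrow> 1 - monom_set D \<in> I"
    and "D \<in> cocycles E \<C>"
  shows "1 - monom_set D \<in> I"
  using \<open>D \<in> cocycles E \<C>\<close>
proof (induction "card D" arbitrary: D rule: less_induct)
  case (less D)
  interpret binary_matroid E \<C> by fact
  note IH = less.hyps and D = less.prems
  have finite_cocycle: "finite A" "A \<subseteq> E" if "A \<in> cocycles E \<C>" for A
    using that finite_ground by (auto simp: cocycles_def intro: finite_subset)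
  consider "D = {}" | "D \<noteq> {}" "D \<notin> cocircuits E \<C>" |
    "D \<in> cocircuits E \<C>" "chordless E \<C> D" | "D \<in> cocircuits E \<C>" "\<not> chordless E \<C> D"
    by blast
  then show ?case
  proof cases
    case 1
    then show ?thesis by (simp add: zero_mem)
  next
    case 2
    then obtain A where A: "A \<in> cocycles E \<C>" "A \<noteq> {}" "A \<subset> D"
      using D by (auto simp: cocircuits_def)
    \<comment> \<open>The rest of \<open>D\<close> is again a cocycle, and it is smaller than
      \<open>D\<close> because \<open>A\<close> is nonempty.\<close>
    have sd: "sym_diff D A = D - A" using A by blast
    have B: "D - A \<in> cocycles E \<C>"
      using cocycles_sym_diff[OF finite_ground D A(1)] unfolding sd .
    have "1 - monom_set A \<in> I" "1 - monom_set (D - A) \<in> I"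
      using A finite_cocycle[OF D] by (auto intro!: IH A B psubset_card_mono)
    then have "1 * 1 - monom_set A * monom_set (D - A) \<in> I"
      using A finite_cocycle[OF A(1)] by (intro diff_mult_mem) auto
    moreover have "monom_set A * monom_set (D - A) = monom_set D"
      using A finite_cocycle[OF D] finite_cocycle[OF A(1)]
      by (subst monom_set_Un_disjoint[symmetric]) (auto intro: arg_cong[where f = monom_set])
    ultimately show ?thesis by simp
  next
    case 3
    then show ?thesis by (rule gen)
  next
    case 4
    then obtain e A B where e: "e \<in> E - D" and A: "A \<in> cocycles E \<C>" and B: "B \<in> cocycles E \<C>"
      and AB: "A \<inter> B = {e}" "D = sym_diff A B"
      by (auto simp: chordless_def is_chord_def)
    note fin = finite_cocycle[OF A] finite_cocycle[OF B] finite_cocycle[OF D]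
    have "card D = card (A - B) + card (B - A)"
      unfolding AB(2) using fin by (intro card_Un_disjoint) auto
    moreover have "card (A - B) = card A - 1"
      using card_Diff_subset_Int[of A B] fin AB by simp
    moreover have "card (B - A) = card B - 1"
      using card_Diff_subset_Int[of B A] fin AB by (simp add: Int_commute)
    \<comment> \<open>Both sets contain \<open>e\<close>, hence are nonempty. The bounds make the
      natural subtractions above exact and give \<open>card D \<ge> card A + 1\<close>, likewise for
      \<open>B\<close>.\<close>
    moreover have "3 \<le> card A" "3 \<le> card B"
      using AB A B finite_ground assms(2) by (auto intro!: cosimple_card_cocycle)
    ultimately have small: "card A < card D" "card B < card D" by linarith+
    have "1 * 1 - monom_set A * monom_set B \<in> I"
      using fin by (intro diff_mult_mem IH A B small) auto
    moreover have "monom_set D * (Var e ^ 2 - 1) \<in> I"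
      using fin e by (intro mult_mem Var_square) auto
    moreover have "monom_set A * monom_set B = monom_set D * Var e ^ 2"
    proof -
      have "monom_set A * monom_set B = monom_set (sym_diff A B) * monom_set (A \<inter> B) ^ 2"
        using fin by (intro monom_set_mult)
      also have "\<dots> = monom_set D * Var e ^ 2"
        unfolding AB(2)[symmetric] AB(1) by (simp add: monom_set_def)
      finally show ?thesis .
    qed
    \<comment> \<open>The added multiple of \<open>Var e ^ 2 - 1\<close> removes the square of the
      chord variable.\<close>
    ultimately have "(1 - monom_set D * Var e ^ 2) + monom_set D * (Var e ^ 2 - 1) \<in> I"
      by (intro add_mem) auto
    then show ?thesis by (simp add: algebra_simps)
  qed
qed

text \<open>The generators vanish at all cycle vectors. Conversely, an element of the cycle ideal is
  congruent, modulo the generated ideal, to a combination over \<open>\<F>\<close>; that combination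
  lies in the cycle ideal too, so independence makes it zero.\<close>

lemma (in binary_matroid) genideal_cycle_generators:
  assumes \<F>: "distinct_representatives (Pow E) (cocycle_rel E \<C>) \<F>" and "cosimple E \<C>"
  shows "Idl\<^bsub>poly_ring E\<^esub> (cycle_generators E \<C>) = cycle_ideal E \<C>"
proof
  interpret P: cring "poly_ring E" by (rule cring_poly_ring)
  interpret C: cocycle_ideal E "cycle_ideal E \<C>" \<C> by (rule cocycle_ideal_cycle_ideal)
  let ?J = "Idl\<^bsub>poly_ring E\<^esub> (cycle_generators E \<C>)"
  have sub: "cycle_generators E \<C> \<subseteq> cycle_ideal E \<C>"
    by (auto simp: cycle_generators_def cocircuits_def intro: C.Var_square C.cocycle_mem)
  then show JI: "?J \<subseteq> cycle_ideal E \<C>"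
    by (intro P.genideal_minimal ideal_cycle_ideal)
  have carr: "cycle_generators E \<C> \<subseteq> carrier (poly_ring E)"
    using sub C.mem_poly_ring by blast
  have gen: "cycle_generators E \<C> \<subseteq> ?J" by (rule P.genideal_self[OF carr])
  \<comment> \<open>Two stages: the squares alone make \<open>cocycle_mem_of_chordless\<close>
    available, which then supplies the remaining axiom of \<open>cocycle_ideal\<close>.\<close>
  interpret J: square_ideal E ?J
  proof (intro square_ideal.intro poly_ideal.intro square_ideal_axioms.intro)
    show "ideal ?J (poly_ring E)" by (rule P.genideal_ideal[OF carr])
    show "Var e ^ 2 - 1 \<in> ?J" if "e \<in> E" for e
      using that by (intro subsetD[OF gen]) (auto simp: cycle_generators_def)
  qed
  interpret J: cocycle_ideal E ?J \<C>
  proof unfold_locales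
    fix D assume "D \<in> cocycles E \<C>"
    moreover have "1 - monom_set D' \<in> ?J" if "D' \<in> cocircuits E \<C>" "chordless E \<C> D'" for D'
      using that by (intro subsetD[OF gen]) (auto simp: cycle_generators_def)
    ultimately show "1 - monom_set D \<in> ?J"
      using J.cocycle_mem_of_chordless binary_matroid_axioms assms(2) by blast
  qed
  show "cycle_ideal E \<C> \<subseteq> ?J"
  proof
    fix p assume p: "p \<in> cycle_ideal E \<C>"
    obtain a where a: "p - (\<Sum>G\<in>\<F>. Const (a G) * monom_set G) \<in> ?J" (is "p - ?q \<in> _")
      using J.exists_normal_form[OF \<F> C.mem_poly_ring[OF p]] .
    have "p - (p - ?q) \<in> cycle_ideal E \<C>"
      by (intro C.diff_mem p subsetD[OF JI] a)
    then have "?q \<in> cycle_ideal E \<C>" by (simp only: diff_diff_eq2 add_diff_cancel_left')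
    then have "a G = 0" if "G \<in> \<F>" for G
      using characters_independent[OF \<F> _ that] by blast
    then have "?q = 0" by (simp add: Const_def)
    with a show "p \<in> ?J" by simp
  qed
qed

section \<open>The basis of the quotient\<close>

text \<open>Carries linear combinations in the quotient back to polynomials. \<open>lincomb\<close>
  sums over a set of cosets, so injectivity is what keeps one summand per index.\<close>

lemma (in poly_ideal) lincomb_cosets:
  assumes "finite S" "f ` S \<subseteq> carrier (poly_ring E)"
    and "inj_on (\<lambda>i. I +>\<^bsub>poly_ring E\<^esub> f i) S"
  shows "LinearCombinations.module.lincomb (quotient_space E I) a ((\<lambda>i. I +>\<^bsub>poly_ring E\<^esub> f i) ` S) =
    I +>\<^bsub>poly_ring E\<^esub> (\<Sum>i\<in>S. Const (a (I +>\<^bsub>poly_ring E\<^esub> f i)) * f i)"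
proof -
  let ?\<phi> = "\<lambda>p. I +>\<^bsub>poly_ring E\<^esub> p"
  interpret V: vectorspace class_ring "quotient_space E I"
    by (rule vectorspace_quotient_space[OF ideal_I])
  have sel: "carrier (quotient_space E I) = carrier (poly_ring E Quot I)"
    "add (quotient_space E I) = add (poly_ring E Quot I)"
    "zero (quotient_space E I) = zero (poly_ring E Quot I)"
    "c \<odot>\<^bsub>quotient_space E I\<^esub> X = ?\<phi> (Const c) \<otimes>\<^bsub>poly_ring E Quot I\<^esub> X" for c X
    by (simp_all add: quotient_space_def ring.defs)
  note hom = rcos_ring_hom
  have closed: "?\<phi> p \<in> carrier (quotient_space E I)" if "p \<in> carrier (poly_ring E)" for p
    using ring_hom_closed[OF hom that] by (simp add: sel)
  have add: "?\<phi> p \<oplus>\<^bsub>quotient_space E I\<^esub> ?\<phi> q = ?\<phi> (p + q)"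
    if "p \<in> carrier (poly_ring E)" "q \<in> carrier (poly_ring E)" for p q
    using ring_hom_add[OF hom that] by (simp add: sel)
  have smult: "c \<odot>\<^bsub>quotient_space E I\<^esub> ?\<phi> p = ?\<phi> (Const c * p)"
    if "p \<in> carrier (poly_ring E)" for c p
    using ring_hom_mult[OF hom Const_in_poly_ring that] by (simp add: sel)
  have zero: "\<zero>\<^bsub>quotient_space E I\<^esub> = ?\<phi> 0"
    using ring_hom_zero[OF hom cring.axioms(1)[OF cring_poly_ring] quotient_is_ring]
    by (simp add: sel)
  show ?thesis
    using assms
  proof (induction S)
    case empty
    then show ?case by (simp add: V.lincomb_def zero)
  next
    case (insert i S)
    have "V.lincomb a (?\<phi> ` f ` S \<union> {?\<phi> (f i)}) =
        a (?\<phi> (f i)) \<odot>\<^bsub>quotient_space E I\<^esub> ?\<phi> (f i) \<oplus>\<^bsub>quotient_space E I\<^esub> V.lincomb a (?\<phi> ` f ` S)"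
      using insert by (intro V.lincomb_insert) (auto intro!: closed)
    also have "\<dots> = ?\<phi> (Const (a (?\<phi> (f i))) * f i) \<oplus>\<^bsub>quotient_space E I\<^esub>
        ?\<phi> (\<Sum>i\<in>S. Const (a (?\<phi> (f i))) * f i)"
      using insert by (simp add: image_image smult)
    also have "\<dots> = ?\<phi> (\<Sum>i\<in>insert i S. Const (a (?\<phi> (f i))) * f i)"
      using insert by (subst add) (auto intro!: sum_in_poly_ring)
    finally show ?case by (simp add: image_image)
  qed
qed

lemma (in binary_matroid) basis_monomial_cosets:
  assumes \<F>: "distinct_representatives (Pow E) (cocycle_rel E \<C>) \<F>"
  shows "vectorspace.basis class_ring (quotient_space E (cycle_ideal E \<C>)) (monomial_cosets E \<C> \<F>)"
proof -
  let ?I = "cycle_ideal E \<C>"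
  let ?\<phi> = "\<lambda>p. ?I +>\<^bsub>poly_ring E\<^esub> p"
  let ?B = "(\<lambda>F. ?\<phi> (monom_set F)) ` \<F>"
  interpret C: cocycle_ideal E ?I \<C> by (rule cocycle_ideal_cycle_ideal)
  interpret V: vectorspace class_ring "quotient_space E ?I"
    by (rule vectorspace_quotient_space[OF ideal_cycle_ideal])
  have \<F>_sub: "\<F> \<subseteq> Pow E" using \<F> by (simp add: distinct_representatives_def)
  have fin\<F>: "finite \<F>" using \<F>_sub finite_ground by (meson finite_Pow_iff finite_subset)
  have B: "monomial_cosets E \<C> \<F> = ?B" by (auto simp: monomial_cosets_def)
  have carr: "carrier (quotient_space E ?I) = carrier (poly_ring E Quot ?I)"
    "\<zero>\<^bsub>quotient_space E ?I\<^esub> = ?I"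
    by (simp_all add: quotient_space_def ring.defs FactRing_def)
  have monom: "monom_set ` \<F> \<subseteq> carrier (poly_ring E)" using \<F>_sub by auto
  have B_carr: "?B \<subseteq> carrier (quotient_space E ?I)"
    using monom ring_hom_closed[OF C.rcos_ring_hom] by (auto simp: carr)
  have inj: "inj_on (\<lambda>F. ?\<phi> (monom_set F)) \<F>"
  proof (rule inj_onI, rule ccontr)
    fix F G assume FG: "F \<in> \<F>" "G \<in> \<F>" "?\<phi> (monom_set F) = ?\<phi> (monom_set G)" "F \<noteq> G"
    \<comment> \<open>Equal cosets would yield the relation with coefficients 1 at \<open>F\<close>
      and -1 at \<open>G\<close>, against independence.\<close>
    let ?a = "\<lambda>H. (if H = F then 1 else 0) - (if H = G then 1 else 0) :: real"
    have "monom_set F - monom_set G \<in> ?I"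
      using FG monom C.coset_eq_iff by (auto simp: image_subset_iff)
    moreover have "(\<Sum>H\<in>\<F>. Const (?a H) * monom_set H) =
        (\<Sum>H\<in>\<F>. (if H = F then monom_set H else 0) - (if H = G then monom_set H else 0))"
      using FG(4) by (intro sum.cong) (auto simp: Const_def single_uminus)
    moreover have "\<dots> = monom_set F - monom_set G"
      using FG fin\<F> by (simp add: sum_subtractf)
    ultimately have "?a F = 0"
      using characters_independent[OF \<F>, of ?a F] FG by simp
    with FG(4) show False by simp
  qed
  note lincomb = C.lincomb_cosets[OF fin\<F> monom inj]
  have indpt: "\<not> V.lin_dep ?B"
  proof (rule V.finite_lin_indpt2)
    show "finite ?B" using fin\<F> by simp
    fix a assume a: "V.lincomb a ?B = \<zero>\<^bsub>quotient_space E ?I\<^esub>"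
    let ?q = "\<Sum>F\<in>\<F>. Const (a (?\<phi> (monom_set F))) * monom_set F"
    have "?\<phi> ?q = ?I" using a by (simp add: lincomb carr)
    moreover have "?q \<in> carrier (poly_ring E)"
      using monom by (auto intro!: sum_in_poly_ring)
    \<comment> \<open>A polynomial lies in its own coset, and here that coset is the ideal
      itself.\<close>
    ultimately have "?q \<in> ?I"
      by (metis C.a_rcos_self)
    then show "\<forall>v\<in>?B. a v = \<zero>\<^bsub>class_ring\<^esub>"
      using characters_independent[OF \<F>] by auto
  qed (use B_carr in auto)
  have "V.span ?B = carrier (quotient_space E ?I)"
  proof
    show "V.span ?B \<subseteq> carrier (quotient_space E ?I)"
      using V.span_is_subset2[OF B_carr] .
    show "carrier (quotient_space E ?I) \<subseteq> V.span ?B"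
    proof
      fix X assume "X \<in> carrier (quotient_space E ?I)"
      then obtain p where p: "p \<in> carrier (poly_ring E)" "X = ?\<phi> p"
        by (auto simp: carr FactRing_def A_RCOSETS_def')
      obtain b where b: "p - (\<Sum>G\<in>\<F>. Const (b G) * monom_set G) \<in> ?I"
        using C.exists_normal_form[OF \<F> p(1)] .
      \<comment> \<open>Coefficients in \<open>lincomb\<close> are attached to cosets, so
        \<open>b\<close> is transported along the inverse of the injective map from representatives
        to cosets.\<close>
      define a where "a v = b (the_inv_into \<F> (\<lambda>F. ?\<phi> (monom_set F)) v)" for v
      have "V.lincomb a ?B = ?\<phi> (\<Sum>G\<in>\<F>. Const (b G) * monom_set G)"
        unfolding lincomb a_def by (simp add: the_inv_into_f_f[OF inj] cong: sum.cong)
      also have "\<dots> = X"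
        unfolding p(2) using b p(1) monom
        by (subst C.coset_eq_iff) (auto intro!: sum_in_poly_ring C.diff_mem_commute)
      finally show "X \<in> V.span ?B"
        unfolding V.span_def using fin\<F> by (auto intro!: exI[of _ a] exI[of _ ?B])
    qed
  qed
  then show ?thesis
    unfolding B V.basis_def using indpt B_carr by blast
qed

text \<open>Cosimplicity guards the generation claim, where it makes the induction over chords
  descend; \<open>generators_fail_without_cosimple\<close> exhibits a matroid violating that
  claim.\<close>

theorem theorem3p4:
  fixes E :: "'e set" and \<C> :: "'e set set" and \<F> :: "'e set set"
  assumes "binary_matroid E \<C>"
    and "distinct_representatives (Pow E) (cocycle_rel E \<C>) \<F>"
  shows "vectorspace.basis class_ring (quotient_space E (cycle_ideal E \<C>))
           (monomial_cosets E \<C> \<F>) \<and>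
         (cosimple E \<C> \<longrightarrow>
           Idl\<^bsub>poly_ring E\<^esub> (cycle_generators E \<C>) = cycle_ideal E \<C>)"
proof -
  interpret binary_matroid E \<C> by fact
  show ?thesis
    using basis_monomial_cosets[OF assms(2)] genideal_cycle_generators[OF assms(2)] by blast
qed

end
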